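(* There is a context-free language $A\subseteq 2^{<\omega}$ such that the $\omega$-power $A^\omega$ belongs to ${\bf\Sigma}^0_2(2^\omega)$ but not to ${\bf\Pi}^0_2(2^\omega)$.
   Context: $2=\{0,1\}$; $2^{<\omega}$ is the set of finite words over $\{0,1\}$ and $2^\omega$ the set of infinite words over $\{0,1\}$ with the Cantor topology (product of the discrete topology). For $V\subseteq 2^{<\omega}$, $V^\omega=\{u_1u_2\cdots u_n\cdots\in 2^\omega : u_i\in V \text{ for all } i\ge1\}$. ${\bf\Sigma}^0_2$ denotes the class of countable unions of closed sets, and ${\bf\Pi}^0_2$ the class of countable intersections of open sets. *)

theory Defs
  imports "HOL-Analysis.Analysis"
begin

datatype ('n, 't) sym = Nt 'n | Tm 't

type_synonym ('n, 't) prods = "('n \<times> ('n, 't) sym list) set"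

inductive derives1 :: "('n, 't) prods \<Rightarrow> ('n, 't) sym list \<Rightarrow> ('n, 't) sym list \<Rightarrow> bool"
  for P where
  "(N, \<alpha>) \<in> P \<Longrightarrow> derives1 P (\<beta> @ [Nt N] @ \<gamma>) (\<beta> @ \<alpha> @ \<gamma>)"

definition grammar_lang :: "('n, 't) prods \<Rightarrow> 'n \<Rightarrow> 't list set" where
  "grammar_lang P S = {w. (derives1 P)\<^sup>*\<^sup>* [Nt S] (map Tm w)}"

(* A grammar with finitely many productions uses finitely many nonterminals,
   so drawing the nonterminals from nat loses no generality. *)
definition context_free :: "'t list set \<Rightarrow> bool" where
  "context_free L \<longleftrightarrow> (\<exists>(P :: (nat, 't) prods) S. finite P \<and> L = grammar_lang P S)"

(* x = u 0 @ u 1 @ ...: every finite concatenation is a prefix of x, and these prefixes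
   exhaust x.  The u i may be empty, as long as the total concatenation is infinite. *)
definition is_infinite_concat :: "(nat \<Rightarrow> 'a list) \<Rightarrow> (nat \<Rightarrow> 'a) \<Rightarrow> bool" where
  "is_infinite_concat u x \<longleftrightarrow>
     (\<forall>n. let w = concat (map u [0..<n]) in w = map x [0..<length w]) \<and>
     (\<forall>k. \<exists>n. k \<le> length (concat (map u [0..<n])))"

definition omega_power :: "'a list set \<Rightarrow> (nat \<Rightarrow> 'a) set" where
  "omega_power V = {x. \<exists>u. (\<forall>i. u i \<in> V) \<and> is_infinite_concat u x}"

definition cantor_space :: "(nat \<Rightarrow> bool) topology" where
  "cantor_space = product_topology (\<lambda>_. discrete_topology UNIV) UNIV"

end

theory Submission
  imports Defs
begin

text \<open>
  Read a word as a path with an up-step for True and a down-step for False.  Let A consist of the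
  words u 1 v with u, v Dyck words, together with the Dyck words of length at least 4 that do not
  start with 1011.  Cutting a path at its returns to the final minimal level shows that the
  omega-power of A consists of those nonnegative paths which, if they start with 1011, eventually
  stay at height at least 1: a path starting with 1011 must use a word u 1 v first, and that word
  lifts the path by 1 forever.  This set is a countable union of closed sets.  Within the closed
  set of nonnegative paths starting with 1011, both it and its complement (the paths returning to
  0 infinitely often) are dense, so by the Baire category theorem they are not both countable
  intersections of open sets.
\<close>

section \<open>Derivations in context-free grammars\<close>

lemma derives1_context: "derives1 P \<alpha> \<beta> \<Longrightarrow> derives1 P (\<gamma> @ \<alpha> @ \<delta>) (\<gamma> @ \<beta> @ \<delta>)"
proof (induction rule: derives1.induct)
  case (1 N \<alpha> \<beta> \<gamma>')
  then show ?case
    using derives1.intros[of N \<alpha> P "\<gamma> @ \<beta>" "\<gamma>' @ \<delta>"] by simp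
qed

lemma derives_context:
  "(derives1 P)\<^sup>*\<^sup>* \<alpha> \<beta> \<Longrightarrow> (derives1 P)\<^sup>*\<^sup>* (\<gamma> @ \<alpha> @ \<delta>) (\<gamma> @ \<beta> @ \<delta>)"
proof (induction rule: rtranclp_induct)
  case (step \<beta> \<eta>)
  then show ?case
    by (meson derives1_context rtranclp.rtrancl_into_rtrancl)
qed simp

lemma derives_append:
  assumes "(derives1 P)\<^sup>*\<^sup>* \<alpha> \<alpha>'" "(derives1 P)\<^sup>*\<^sup>* \<beta> \<beta>'"
  shows "(derives1 P)\<^sup>*\<^sup>* (\<alpha> @ \<beta>) (\<alpha>' @ \<beta>')"
  using derives_context[OF assms(1), of "[]" \<beta>] derives_context[OF assms(2), of \<alpha>' "[]"] by simp

lemma derives_Cons: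
  assumes "(derives1 P)\<^sup>*\<^sup>* \<beta> \<beta>'"
  shows "(derives1 P)\<^sup>*\<^sup>* (s # \<beta>) (s # \<beta>')"
  using derives_append[OF _ assms, of "[s]" "[s]"] by simp

lemma derives_production:
  assumes "(N, \<alpha>) \<in> P" "(derives1 P)\<^sup>*\<^sup>* \<alpha> \<beta>"
  shows "(derives1 P)\<^sup>*\<^sup>* [Nt N] \<beta>"
  using derives1.intros[OF assms(1), of "[]" "[]"] assms(2)
  by (auto intro: converse_rtranclp_into_rtranclp)

text \<open>Reads a sentential form as a language once each nonterminal is assigned one. It serves
  as the invariant that bounds a generated language from above.\<close>

fun instances :: "('n \<Rightarrow> 't list set) \<Rightarrow> ('n, 't) sym list \<Rightarrow> 't list set" where
  "instances L [] = {[]}"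
| "instances L (Tm a # \<alpha>) = (#) a ` instances L \<alpha>"
| "instances L (Nt N # \<alpha>) = (\<Union>u\<in>L N. (@) u ` instances L \<alpha>)"

lemma instances_append:
  "instances L (\<alpha> @ \<beta>) = (\<Union>u\<in>instances L \<alpha>. (@) u ` instances L \<beta>)"
  by (induction L \<alpha> rule: instances.induct) (auto simp: image_UN image_image)

lemma instances_Tm: "instances L (map Tm w) = {w}"
  by (induction w) auto

text \<open>The hypothesis makes \<open>L\<close> a pre-fixed point of the productions. Rewriting
  \<open>N\<close> by a right-hand side replaces the factor \<open>L N\<close> of a concatenation by
  a subset, so instances can only be lost along a derivation.\<close>

lemma derives_instances:
  assumes "\<And>N \<alpha>. (N, \<alpha>) \<in> P \<Longrightarrow> instances L \<alpha> \<subseteq> L N"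
  shows "(derives1 P)\<^sup>*\<^sup>* \<alpha> \<beta> \<Longrightarrow> instances L \<beta> \<subseteq> instances L \<alpha>"
proof (induction rule: rtranclp_induct)
  case (step \<beta> \<gamma>)
  have "instances L \<gamma> \<subseteq> instances L \<beta>"
    using step.hyps(2)
  proof cases
    case (1 N \<eta> \<beta>1 \<beta>2)
    then show ?thesis
      using assms[OF 1(3)] unfolding 1 instances_append instances.simps
      by (intro UN_mono subset_refl image_mono) auto
  qed
  then show ?case
    using step.IH by blast
qed simp

lemma grammar_lang_subset:
  assumes "\<And>N \<alpha>. (N, \<alpha>) \<in> P \<Longrightarrow> instances L \<alpha> \<subseteq> L N"
  shows "grammar_lang P S \<subseteq> L S"
proof
  fix w assume "w \<in> grammar_lang P S"
  then have "(derives1 P)\<^sup>*\<^sup>* [Nt S] (map Tm w)"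
    by (simp add: grammar_lang_def)
  from derives_instances[of P L, OF assms this] show "w \<in> L S"
    by (simp add: instances_Tm)
qed

section \<open>Dyck words\<close>

definition balance :: "bool list \<Rightarrow> int" where
  "balance w = (\<Sum>b\<leftarrow>w. if b then 1 else - 1)"

lemma balance_simps [simp]:
  "balance [] = 0"
  "balance (b # w) = (if b then 1 else - 1) + balance w"
  "balance (v @ w) = balance v + balance w"
  by (simp_all add: balance_def)

definition dyck :: "bool list set" where
  "dyck = {w. balance w = 0 \<and> (\<forall>k. 0 \<le> balance (take k w))}"

lemma dyckD: "w \<in> dyck \<Longrightarrow> balance w = 0" "w \<in> dyck \<Longrightarrow> 0 \<le> balance (take k w)"
  by (auto simp: dyck_def)

lemma dyck_Nil [simp]: "[] \<in> dyck"
  by (simp add: dyck_def)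

lemma dyck_append: "u \<in> dyck \<Longrightarrow> v \<in> dyck \<Longrightarrow> u @ v \<in> dyck"
  by (auto simp: dyck_def)

lemma dyck_wrap:
  assumes "u \<in> dyck"
  shows "True # u @ [False] \<in> dyck"
proof -
  have "0 \<le> balance (take k (True # u @ [False]))" for k
  proof (cases k)
    case (Suc j)
    have "balance (take j [False]) \<ge> - 1" for j
      by (cases j) auto
    then show ?thesis
      using dyckD(2)[OF assms, of j] Suc
      by (cases "j \<le> length u") (auto simp: dyckD(1)[OF assms])
  qed simp
  then show ?thesis
    using dyckD(1)[OF assms] by (auto simp: dyck_def)
qed

lemma dyck_wrap_append: "u \<in> dyck \<Longrightarrow> v \<in> dyck \<Longrightarrow> True # u @ False # v \<in> dyck"
  using dyck_append[OF dyck_wrap] by fastforce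

text \<open>First-return decomposition: cut at the first positive position of balance 0. Strictly
  before it the path stays at height at least 1, so removing the enclosing pair of steps leaves a
  Dyck word.\<close>

lemma dyck_decompose:
  assumes "w \<in> dyck" "w \<noteq> []"
  obtains u v where "w = True # u @ False # v" "u \<in> dyck" "v \<in> dyck"
proof -
  have hd: "w = True # tl w"
    using dyckD(2)[OF assms(1), of 1] assms(2) by (cases w) (auto split: if_splits)
  define k where "k = (LEAST k. 0 < k \<and> balance (take k w) = 0)"
  have ex: "0 < length w \<and> balance (take (length w) w) = 0"
    using assms by (simp add: dyckD(1))
  have k: "0 < k" "balance (take k w) = 0"
    using LeastI[of "\<lambda>k. 0 < k \<and> balance (take k w) = 0", OF ex] by (auto simp: k_def)
  have k_le: "k \<le> length w"
    unfolding k_def using ex by (rule Least_le)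
  have least: "balance (take j w) \<ge> 1" if "0 < j" "j < k" for j
  proof -
    have "balance (take j w) \<noteq> 0"
      using not_less_Least[of j "\<lambda>k. 0 < k \<and> balance (take k w) = 0"] that
      by (simp add: k_def)
    then show ?thesis
      using dyckD(2)[OF assms(1), of j] by linarith
  qed
  \<comment> \<open>After one step the path is at height 1, so the first return takes at least two
    steps. In \<open>k = Suc (Suc j)\<close> the number \<open>j\<close> is the length of the inner
    word \<open>u\<close>.\<close>
  have "take 1 w = [True]"
    by (subst hd) simp
  then have "k \<noteq> 1"
    using k(2) by auto
  then obtain j where j: "k = Suc (Suc j)"
    using k(1) by (metis One_nat_def gr0_implies_Suc not_gr_zero)
  have tk: "take k w = take (Suc j) w @ [w ! Suc j]"
    using k_le j by (simp add: take_Suc_conv_app_nth)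
  have b1: "balance (take (Suc j) w) \<ge> 1"
    by (rule least) (auto simp: j)
  then have nth: "w ! Suc j = False" and b2: "balance (take (Suc j) w) = 1"
    using k(2) unfolding tk by (auto split: if_splits)
  define u where "u = take j (tl w)"
  define v where "v = drop k w"
  have tu: "take (Suc j) w = True # u"
    unfolding u_def by (subst hd) simp
  have eq: "w = True # u @ False # v"
    using append_take_drop_id[of k w] unfolding tk tu nth v_def by simp
  have lu: "length u = j"
    using tu k_le j by (metis Suc_le_lessD length_Cons length_take less_imp_le_nat min.absorb2 nat.inject)
  have "u \<in> dyck"
  proof -
    have "0 \<le> balance (take i u)" for i
    proof (cases "i \<le> j")
      case True
      then have "take (Suc i) w = True # take i u"
        using lu by (subst eq) simp
      then show ?thesis
        using least[of "Suc i"] True j by simp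
    next
      case False
      then show ?thesis
        using b2 tu lu by simp
    qed
    then show ?thesis
      using b2 tu by (simp add: dyck_def)
  qed
  moreover have "v \<in> dyck"
  proof -
    have "balance (take k w) + balance (take i v) = balance (take (k + i) w)" for i
      by (simp add: v_def take_add)
    moreover have "balance (take k w) + balance v = balance w"
      unfolding v_def by (metis append_take_drop_id balance_simps(3))
    ultimately show ?thesis
      using k(2) dyckD[OF assms(1)] by (simp add: dyck_def)
  qed
  ultimately show ?thesis
    using eq that by blast
qed

section \<open>The language and its grammar\<close>

definition lang :: "bool list set" where
  "lang = {u @ True # v | u v. u \<in> dyck \<and> v \<in> dyck} \<union>
    {w \<in> dyck. 4 \<le> length w \<and> take 4 w \<noteq> [True, False, True, True]}"

definition lang_prods :: "(nat, bool) prods" where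
  "lang_prods =
    {(0, [Nt 1, Tm True, Nt 1]),
     (0, [Tm True, Tm True, Nt 1, Tm False, Nt 1, Tm False, Nt 1]),
     (0, [Tm True, Tm False, Tm True, Tm False, Nt 1]),
     (1, []),
     (1, [Tm True, Nt 1, Tm False, Nt 1])}"

text \<open>Apply the first-return decomposition twice. If the first arch is nonempty, decompose its
  interior. If it is empty, the length forces a second arch, which must be empty too, since
  otherwise the word would start with 1011.\<close>

lemma long_dyck_cases:
  assumes "w \<in> dyck" "4 \<le> length w" "take 4 w \<noteq> [True, False, True, True]"
  shows "(\<exists>u v t. w = True # True # u @ False # v @ False # t \<and> u \<in> dyck \<and> v \<in> dyck \<and> t \<in> dyck) \<or>
    (\<exists>t. w = True # False # True # False # t \<and> t \<in> dyck)"
proof -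
  have "w \<noteq> []"
    using assms(2) by auto
  then obtain u v where w: "w = True # u @ False # v" "u \<in> dyck" "v \<in> dyck"
    by (rule dyck_decompose[OF assms(1)])
  show ?thesis
  proof (cases "u = []")
    case False
    obtain u1 u2 where "u = True # u1 @ False # u2" "u1 \<in> dyck" "u2 \<in> dyck"
      by (rule dyck_decompose[OF w(2) False])
    then show ?thesis
      using w by auto
  next
    case True
    then have "v \<noteq> []"
      using w assms(2) by auto
    then obtain v1 v2 where v: "v = True # v1 @ False # v2" "v1 \<in> dyck" "v2 \<in> dyck"
      by (rule dyck_decompose[OF w(3)])
    have "v1 = []"
    proof (rule ccontr)
      assume "v1 \<noteq> []"
      then obtain t where "v1 = True # t"
        using dyck_decompose[OF v(2)] by blast
      then show False
        using assms(3) w(1) True v(1) by (simp add: numeral_eq_Suc)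
    qed
    then show ?thesis
      using w(1) True v by simp
  qed
qed

lemma grammar_lang_eq: "grammar_lang lang_prods 0 = lang"
proof
  \<comment> \<open>The pre-fixed point for soundness: the start symbol stands for
    \<open>lang\<close>, nonterminal 1 for \<open>dyck\<close>.\<close>
  define L :: "nat \<Rightarrow> bool list set" where "L N = (if N = 0 then lang else dyck)" for N
  have peak: "True # True # u @ False # v @ False # t \<in> dyck"
    if "u \<in> dyck" "v \<in> dyck" "t \<in> dyck" for u v t
    using dyck_wrap_append[OF dyck_wrap_append[OF that(1,2)] that(3)] by simp
  have flat: "True # False # True # False # t \<in> dyck" if "t \<in> dyck" for t
    using dyck_wrap_append[OF dyck_Nil dyck_wrap_append[OF dyck_Nil that]] by simp
  have "instances L [Nt 1, Tm True, Nt 1] \<subseteq> L 0"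
    by (auto simp: L_def lang_def)
  moreover have "instances L [Tm True, Tm True, Nt 1, Tm False, Nt 1, Tm False, Nt 1] \<subseteq> L 0"
    using peak by (auto simp: L_def lang_def numeral_eq_Suc)
  moreover have "instances L [Tm True, Tm False, Tm True, Tm False, Nt 1] \<subseteq> L 0"
    using flat by (auto simp: L_def lang_def numeral_eq_Suc)
  moreover have "instances L [] \<subseteq> L 1"
    by (simp add: L_def)
  moreover have "instances L [Tm True, Nt 1, Tm False, Nt 1] \<subseteq> L 1"
    using dyck_wrap_append by (auto simp: L_def)
  ultimately have "instances L \<alpha> \<subseteq> L N" if "(N, \<alpha>) \<in> lang_prods" for N \<alpha>
    using that unfolding lang_prods_def by blast
  from grammar_lang_subset[where S = 0, OF this] show "grammar_lang lang_prods 0 \<subseteq> lang"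
    by (simp add: L_def)
next
  let ?D = "(derives1 lang_prods)\<^sup>*\<^sup>*"
  have dyck: "?D [Nt 1] (map Tm w)" if "w \<in> dyck" for w
    using that
  proof (induction w rule: length_induct)
    case (1 w)
    show ?case
    proof (cases "w = []")
      case True
      show ?thesis
        by (rule derives_production[of _ "[]"]) (auto simp: True lang_prods_def)
    next
      case False
      \<comment> \<open>Both \<open>u\<close> and \<open>v\<close> are shorter than
        \<open>w\<close>, so the induction hypothesis derives each of them from nonterminal
        1.\<close>
      obtain u v where w: "w = True # u @ False # v" "u \<in> dyck" "v \<in> dyck"
        by (rule dyck_decompose[OF 1(2) False])
      have "?D [Nt 1] (map Tm u)" "?D [Nt 1] (map Tm v)"
        using w 1(1) by auto
      then have "?D (Tm True # [Nt 1] @ Tm False # [Nt 1]) (Tm True # map Tm u @ Tm False # map Tm v)"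
        by (intro derives_Cons derives_append)
      then show ?thesis
        by (intro derives_production[of 1 "[Tm True, Nt 1, Tm False, Nt 1]"])
          (auto simp: w lang_prods_def)
    qed
  qed
  show "lang \<subseteq> grammar_lang lang_prods 0"
  proof
    fix w assume "w \<in> lang"
    then consider (up) u v where "w = u @ True # v" "u \<in> dyck" "v \<in> dyck"
      | (peak) u v t where "w = True # True # u @ False # v @ False # t"
        "u \<in> dyck" "v \<in> dyck" "t \<in> dyck"
      | (flat) t where "w = True # False # True # False # t" "t \<in> dyck"
      using long_dyck_cases unfolding lang_def by blast
    then have "?D [Nt 0] (map Tm w)"
    proof cases
      case up
      then have "?D ([Nt 1] @ Tm True # [Nt 1]) (map Tm u @ Tm True # map Tm v)"
        by (intro derives_Cons derives_append dyck)
      then show ?thesis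
        by (intro derives_production[of 0 "[Nt 1, Tm True, Nt 1]"]) (auto simp: up lang_prods_def)
    next
      case peak
      then have "?D (Tm True # Tm True # [Nt 1] @ Tm False # [Nt 1] @ Tm False # [Nt 1])
          (Tm True # Tm True # map Tm u @ Tm False # map Tm v @ Tm False # map Tm t)"
        by (intro derives_Cons derives_append dyck)
      then show ?thesis
        by (intro derives_production[of 0 "[Tm True, Tm True, Nt 1, Tm False, Nt 1, Tm False, Nt 1]"])
          (auto simp: peak lang_prods_def)
    next
      case flat
      then have "?D (Tm True # Tm False # Tm True # Tm False # [Nt 1])
          (Tm True # Tm False # Tm True # Tm False # map Tm t)"
        by (intro derives_Cons dyck)
      then show ?thesis
        by (intro derives_production[of 0 "[Tm True, Tm False, Tm True, Tm False, Nt 1]"])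
          (auto simp: flat lang_prods_def)
    qed
    then show "w \<in> grammar_lang lang_prods 0"
      by (simp add: grammar_lang_def)
  qed
qed

lemma context_free_lang: "context_free lang"
proof -
  have "finite lang_prods"
    by (simp add: lang_prods_def)
  then show ?thesis
    using grammar_lang_eq unfolding context_free_def by metis
qed

section \<open>Unfolding and coinduction for omega-powers\<close>

definition seq_drop :: "nat \<Rightarrow> (nat \<Rightarrow> 'a) \<Rightarrow> nat \<Rightarrow> 'a" where
  "seq_drop n x = (\<lambda>i. x (n + i))"

lemma seq_drop_seq_drop: "seq_drop m (seq_drop n x) = seq_drop (n + m) x"
  by (simp add: seq_drop_def add.assoc)

lemma map_upt_add: "map x [0..<m + n] = map x [0..<m] @ map (seq_drop m x) [0..<n]"
  by (induction n) (simp_all add: seq_drop_def)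

text \<open>Split off the first factor; the remaining factors still form an infinite concatenation.
  Excluding the empty word from \<open>V\<close> makes the cut positive, which permits induction on
  positions.\<close>

lemma omega_powerE:
  assumes "x \<in> omega_power V" "[] \<notin> V"
  obtains n where "0 < n" "map x [0..<n] \<in> V" "seq_drop n x \<in> omega_power V"
proof -
  obtain u where u: "\<And>i. u i \<in> V" and "is_infinite_concat u x"
    using assms(1) by (auto simp: omega_power_def)
  then have pre: "concat (map u [0..<k]) = map x [0..<length (concat (map u [0..<k]))]"
    and len: "\<exists>k. l \<le> length (concat (map u [0..<k]))" for k l
    unfolding is_infinite_concat_def Let_def by blast+
  define n where "n = length (u 0)"
  define W where "W k = concat (map (\<lambda>i. u (Suc i)) [0..<k])" for k
  have Suc: "concat (map u [0..<Suc k]) = u 0 @ W k" for k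
    by (induction k) (simp_all add: W_def)
  have "concat (map u [0..<1]) = u 0"
    by simp
  with pre[of 1] have u0: "u 0 = map x [0..<n]"
    unfolding n_def by (simp only:)
  have "W k = map (seq_drop n x) [0..<length (W k)]" for k
  proof -
    have "u 0 @ W k = map x [0..<n + length (W k)]"
      using pre[of "Suc k"] unfolding Suc length_append n_def .
    then show ?thesis
      unfolding map_upt_add u0 same_append_eq .
  qed
  moreover have "\<exists>k. l \<le> length (W k)" for l
  proof -
    \<comment> \<open>Ask for \<open>n + l\<close> letters because the first factor accounts for
      \<open>n\<close> of them.\<close>
    obtain k where "n + l \<le> length (concat (map u [0..<k]))"
      using len by blast
    also have "\<dots> \<le> length (concat (map u [0..<Suc k]))"
      by simp
    finally show ?thesis
      unfolding Suc by (auto simp: n_def)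
  qed
  ultimately have "is_infinite_concat (\<lambda>i. u (Suc i)) (seq_drop n x)"
    unfolding is_infinite_concat_def Let_def W_def[symmetric] by blast
  then have "seq_drop n x \<in> omega_power V"
    unfolding omega_power_def using u by (intro CollectI exI[of _ "\<lambda>i. u (Suc i)"]) simp
  moreover have "0 < n" "map x [0..<n] \<in> V"
    using u[of 0] assms(2) unfolding u0 by (auto intro: gr0I)
  ultimately show ?thesis
    by (rule that[rotated 2])
qed

text \<open>Cutting off a factor never leaves \<open>Q\<close>, so the cutting can be iterated
  forever, and the pieces cut off form the required factorization.\<close>

lemma omega_power_coinduct:
  assumes "x \<in> Q"
    and "\<And>y. y \<in> Q \<Longrightarrow> \<exists>n>0. map y [0..<n] \<in> V \<and> seq_drop n y \<in> Q"
  shows "x \<in> omega_power V"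
proof -
  obtain f where f: "\<And>y. y \<in> Q \<Longrightarrow> 0 < f y \<and> map y [0..<f y] \<in> V \<and> seq_drop (f y) y \<in> Q"
    using assms(2) by metis
  \<comment> \<open>\<open>y k\<close> is the tail left after \<open>k\<close> cuts;
    \<open>N k\<close> below is the position in \<open>x\<close> where it begins.\<close>
  define y where "y = rec_nat x (\<lambda>_ y. seq_drop (f y) y)"
  have y: "y 0 = x" "y (Suc k) = seq_drop (f (y k)) (y k)" for k
    by (simp_all add: y_def)
  define u where "u k = map (y k) [0..<f (y k)]" for k
  define N where "N k = (\<Sum>i<k. f (y i))" for k
  have yQ: "y k \<in> Q" for k
  proof (induction k)
    case 0
    then show ?case
      unfolding y by (rule assms(1))
  next
    case (Suc k)
    then show ?case
      unfolding y using f by blast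
  qed
  have y_drop: "y k = seq_drop (N k) x" for k
    by (induction k) (simp_all add: y N_def seq_drop_seq_drop, simp add: seq_drop_def)
  have pre: "concat (map u [0..<k]) = map x [0..<N k]" for k
  proof (induction k)
    case (Suc k)
    then show ?case
      by (simp add: u_def N_def map_upt_add y_drop[unfolded N_def, symmetric])
  qed (simp add: N_def)
  \<comment> \<open>Every cut has positive length, so the finite concatenations exhaust
    \<open>x\<close>.\<close>
  have "k \<le> N k" for k
  proof (induction k)
    case (Suc k)
    then show ?case
      using f[OF yQ[of k]] by (simp add: N_def)
  qed simp
  then have "\<exists>n. k \<le> length (concat (map u [0..<n]))" for k
    unfolding pre by auto
  then have "is_infinite_concat u x"
    by (simp add: is_infinite_concat_def Let_def pre)
  moreover have "u k \<in> V" for k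
    using f[OF yQ] by (simp add: u_def)
  ultimately show ?thesis
    by (auto simp: omega_power_def)
qed

section \<open>Path heights and the omega-power of the language\<close>

definition height :: "(nat \<Rightarrow> bool) \<Rightarrow> nat \<Rightarrow> int" where
  "height x n = balance (map x [0..<n])"

lemma height_simps [simp]:
  "height x 0 = 0"
  "height x (Suc n) = height x n + (if x n then 1 else - 1)"
  by (simp_all add: height_def)

lemma height_add: "height x (m + n) = height x m + height (seq_drop m x) n"
  by (simp add: height_def map_upt_add)

definition nonneg_paths :: "(nat \<Rightarrow> bool) set" where
  "nonneg_paths = {x. \<forall>n. 0 \<le> height x n}"

definition marked :: "(nat \<Rightarrow> bool) set" where
  "marked = {x. map x [0..<4] = [True, False, True, True]}"

definition accepted :: "(nat \<Rightarrow> bool) set" where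
  "accepted = {x \<in> nonneg_paths. x \<in> marked \<longrightarrow> (\<exists>n. \<forall>m\<ge>n. 1 \<le> height x m)}"

lemma height_take_prefix: "k \<le> n \<Longrightarrow> height x k = balance (take k (map x [0..<n]))"
  by (simp add: height_def take_map)

lemma prefix_dyck:
  assumes "x \<in> nonneg_paths" "height x n = 0"
  shows "map x [0..<n] \<in> dyck"
proof -
  have "balance (take k (map x [0..<n])) = height x (min k n)" for k
    by (cases "k \<le> n") (simp_all add: height_def take_map)
  then show ?thesis
    using assms by (simp add: dyck_def nonneg_paths_def height_def)
qed

lemma seq_drop_nonneg:
  assumes "\<And>m. n \<le> m \<Longrightarrow> height x n \<le> height x m"
  shows "seq_drop n x \<in> nonneg_paths"
  unfolding nonneg_paths_def
proof (intro CollectI allI)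
  fix m
  show "0 \<le> height (seq_drop n x) m"
    using assms[of "n + m"] by (simp add: height_add)
qed

lemma Nil_notin_lang: "[] \<notin> lang"
  by (simp add: lang_def)

lemma lang_nonneg:
  assumes "w \<in> lang"
  shows "0 \<le> balance (take k w)"
proof -
  have "0 \<le> balance (take j (True # v))" if "v \<in> dyck" for j v
    using dyckD(2)[OF that, of "j - 1"] by (cases j) simp_all
  then show ?thesis
    using assms by (auto simp: lang_def dyckD(2) intro!: add_nonneg_nonneg)
qed

text \<open>Strong induction on the position. Inside the first factor \<open>lang_nonneg\<close>
  applies; beyond it, the tail is again in the omega-power with a smaller position, and the factor
  ends at a nonnegative height.\<close>

lemma omega_power_lang_nonneg:
  assumes "x \<in> omega_power lang"
  shows "x \<in> nonneg_paths"
proof -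
  have "0 \<le> height x m" for m
    using assms
  proof (induction m arbitrary: x rule: less_induct)
    case (less m)
    obtain n where n: "0 < n" "map x [0..<n] \<in> lang" "seq_drop n x \<in> omega_power lang"
      by (rule omega_powerE[OF less.prems Nil_notin_lang])
    show ?case
    proof (cases "m \<le> n")
      case True
      then show ?thesis
        using lang_nonneg[OF n(2)] by (simp add: height_take_prefix)
    next
      case False
      have "0 \<le> height x n"
        using lang_nonneg[OF n(2), of n] by (simp add: height_def)
      moreover have "0 \<le> height (seq_drop n x) (m - n)"
        using less.IH[of "m - n" "seq_drop n x"] n False by simp
      ultimately show ?thesis
        using height_add[of x n "m - n"] False by simp
    qed
  qed
  then show ?thesis
    by (simp add: nonneg_paths_def)
qed

lemma omega_power_lang_accepted:
  assumes "x \<in> omega_power lang"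
  shows "x \<in> accepted"
proof -
  obtain n where n: "0 < n" "map x [0..<n] \<in> lang" "seq_drop n x \<in> omega_power lang"
    by (rule omega_powerE[OF assms Nil_notin_lang])
  have "\<exists>n. \<forall>m\<ge>n. 1 \<le> height x m" if "x \<in> marked"
  proof -
    \<comment> \<open>A Dyck word of \<open>lang\<close> has at least four letters, so as a first
      factor it would start with the excluded 1011.\<close>
    have "map x [0..<n] \<notin> {w \<in> dyck. 4 \<le> length w \<and> take 4 w \<noteq> [True, False, True, True]}"
      using that by (auto simp: marked_def take_map)
    then obtain u v where "map x [0..<n] = u @ True # v" "u \<in> dyck" "v \<in> dyck"
      using n(2) unfolding lang_def by blast
    then have "height x n = 1"
      by (simp add: height_def dyckD(1))
    moreover have "0 \<le> height (seq_drop n x) k" for k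
      using omega_power_lang_nonneg[OF n(3)] by (simp add: nonneg_paths_def)
    ultimately have "1 \<le> height x m" if "n \<le> m" for m
      using height_add[of x n "m - n"] that by simp
    then show ?thesis
      by blast
  qed
  then show ?thesis
    using omega_power_lang_nonneg[OF assms] by (simp add: accepted_def)
qed

text \<open>A marked path 1011... can be cut after 10, and the tail then starts with 11, hence is unmarked.\<close>
lemma unmarked_tail:
  assumes "y \<in> nonneg_paths"
  obtains k where "map y [0..<k] \<in> dyck" "seq_drop k y \<in> nonneg_paths - marked"
proof (cases "y \<in> marked")
  case False
  then show ?thesis
    using assms that[of 0] by (simp add: seq_drop_def)
next
  case True
  then have y: "y 0" "\<not> y 1" "y 3"
    by (simp_all add: marked_def numeral_eq_Suc)
  then have h: "height y 2 = 0"
    by (simp add: numeral_2_eq_2)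
  have "seq_drop 2 y \<in> nonneg_paths"
    by (rule seq_drop_nonneg) (use assms h in \<open>simp add: nonneg_paths_def\<close>)
  moreover have "seq_drop 2 y \<notin> marked"
    using y by (simp add: marked_def seq_drop_def numeral_eq_Suc)
  ultimately show ?thesis
    using that[of 2] prefix_dyck[OF assms h] by blast
qed

text \<open>The tail is always chosen unmarked, so that nonnegativity alone makes it accepted. If
  \<open>x\<close> eventually stays positive, the factor has the form u 1 v around the up-step that
  leaves level 0 for the last time. Otherwise \<open>x\<close> is unmarked and returns to 0
  arbitrarily late, and the factor is a Dyck word.\<close>

lemma accepted_unfold:
  assumes "x \<in> accepted"
  shows "\<exists>n>0. map x [0..<n] \<in> lang \<and> seq_drop n x \<in> accepted"
proof -
  have nonneg: "x \<in> nonneg_paths" "\<And>m. 0 \<le> height x m"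
    using assms by (auto simp: accepted_def nonneg_paths_def)
  have unmarked: "nonneg_paths - marked \<subseteq> accepted"
    by (auto simp: accepted_def)
  show ?thesis
  proof (cases "\<exists>n. \<forall>m\<ge>n. 1 \<le> height x m")
    case True
    then obtain N where N: "\<And>m. N \<le> m \<Longrightarrow> 1 \<le> height x m"
      by blast
    \<comment> \<open>The last visit to level 0: the zeros all lie before \<open>N\<close>, and
      position 0 is one of them.\<close>
    define n where "n = Max {m. height x m = 0}"
    have "m < N" if "height x m = 0" for m
      using N[of m] that by (cases "m < N") auto
    then have fin: "finite {m. height x m = 0}"
      by (auto intro: finite_subset[of _ "{..<N}"])
    have zero: "height x n = 0"
      using Max_in[OF fin] unfolding n_def by (metis (mono_tags) Collect_empty_eq height_simps(1) mem_Collect_eq)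
    have pos: "1 \<le> height x m" if "n < m" for m
    proof -
      have "height x m \<noteq> 0"
        using Max_ge[OF fin, of m] that by (auto simp: n_def)
      then show ?thesis
        using nonneg(2)[of m] by linarith
    qed
    have xn: "x n" and one: "height x (Suc n) = 1"
      using pos[of "Suc n"] zero by (auto split: if_splits)
    define y where "y = seq_drop (Suc n) x"
    have "y \<in> nonneg_paths"
      unfolding y_def by (rule seq_drop_nonneg) (use pos one in simp)
    \<comment> \<open>The Dyck prefix of \<open>y\<close> becomes the v of the factor u 1 v;
      extending the cut by it makes the tail unmarked.\<close>
    then obtain k where k: "map y [0..<k] \<in> dyck" "seq_drop k y \<in> nonneg_paths - marked"
      by (rule unmarked_tail)
    have "map x [0..<Suc n + k] = map x [0..<n] @ True # map y [0..<k]"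
      unfolding map_upt_add y_def[symmetric] using xn by simp
    then have "map x [0..<Suc n + k] \<in> lang"
      using prefix_dyck[OF nonneg(1) zero] k(1) unfolding lang_def by blast
    moreover have "seq_drop (Suc n + k) x \<in> accepted"
      using k(2) unmarked unfolding y_def seq_drop_seq_drop by blast
    ultimately show ?thesis
      by (intro exI[of _ "Suc n + k"]) simp
  next
    case False
    then have "x \<notin> marked"
      using assms by (auto simp: accepted_def)
    \<comment> \<open>A return at position 4 or later meets the length condition in
      \<open>lang\<close> and makes the first four letters of the factor those of the unmarked
      \<open>x\<close>.\<close>
    obtain n where n: "4 \<le> n" "height x n < 1"
      using False by (meson not_le)
    have zero: "height x n = 0"
      using n(2) nonneg(2)[of n] by linarith
    define y where "y = seq_drop n x"
    have "y \<in> nonneg_paths"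
      unfolding y_def by (rule seq_drop_nonneg) (use nonneg zero in simp)
    then obtain k where k: "map y [0..<k] \<in> dyck" "seq_drop k y \<in> nonneg_paths - marked"
      by (rule unmarked_tail)
    have "map x [0..<n + k] \<in> dyck"
      using prefix_dyck[OF nonneg(1) zero] k(1) unfolding map_upt_add y_def[symmetric]
      by (rule dyck_append)
    moreover have "take 4 (map x [0..<n + k]) = map x [0..<4]"
      using n(1) by (simp add: take_map)
    ultimately have "map x [0..<n + k] \<in> lang"
      using n(1) \<open>x \<notin> marked\<close> by (simp add: lang_def marked_def)
    moreover have "seq_drop (n + k) x \<in> accepted"
      using k(2) unmarked unfolding y_def seq_drop_seq_drop by blast
    ultimately show ?thesis
      using n(1) by (intro exI[of _ "n + k"]) simp
  qed
qed

lemma omega_power_lang: "omega_power lang = accepted"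
  using omega_power_lang_accepted omega_power_coinduct[of _ accepted lang] accepted_unfold by blast

section \<open>Cantor space and Baire category\<close>

lemma topspace_cantor_space [simp]: "topspace cantor_space = UNIV"
  by (simp add: cantor_space_def)

text \<open>A basic open box restricts finitely many coordinates, so it contains the cylinder of any
  prefix covering them. Conversely, a cylinder is a box with singletons at its first
  \<open>n\<close> coordinates.\<close>

lemma openin_cantor_space:
  "openin cantor_space S \<longleftrightarrow> (\<forall>x\<in>S. \<exists>n. \<forall>y. map y [0..<n] = map x [0..<n] \<longrightarrow> y \<in> S)"
proof (rule iffI, rule ballI)
  fix x assume "openin cantor_space S" "x \<in> S"
  then have "\<exists>U. finite {i \<in> UNIV. U i \<noteq> topspace (discrete_topology (UNIV :: bool set))} \<and>
      (\<forall>i\<in>UNIV. openin (discrete_topology UNIV) (U i)) \<and> x \<in> Pi\<^sub>E UNIV U \<and> Pi\<^sub>E UNIV U \<subseteq> S"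
    unfolding cantor_space_def openin_product_topology_alt by (rule bspec)
  then obtain U where "finite {i \<in> UNIV. U i \<noteq> topspace (discrete_topology (UNIV :: bool set))}"
    and U: "x \<in> Pi\<^sub>E UNIV U" "Pi\<^sub>E UNIV U \<subseteq> S"
    by (elim exE conjE)
  then have "finite {i. U i \<noteq> UNIV}"
    by simp
  then obtain n where "\<forall>i\<in>{i. U i \<noteq> UNIV}. i < n"
    unfolding finite_nat_set_iff_bounded ..
  then have n: "i < n" if "U i \<noteq> UNIV" for i
    using that by blast
  have "y \<in> S" if "map y [0..<n] = map x [0..<n]" for y
  proof -
    have "y i \<in> U i" for i
    proof (cases "U i = UNIV")
      case False
      then have "y i = x i"
        using n that by (simp add: map_eq_conv)
      then show ?thesis
        using PiE_mem[OF U(1), of i] by simp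
    qed simp
    then show ?thesis
      using U(2) by auto
  qed
  then show "\<exists>n. \<forall>y. map y [0..<n] = map x [0..<n] \<longrightarrow> y \<in> S"
    by blast
next
  assume *: "\<forall>x\<in>S. \<exists>n. \<forall>y. map y [0..<n] = map x [0..<n] \<longrightarrow> y \<in> S"
  show "openin cantor_space S"
    unfolding cantor_space_def openin_product_topology_alt
  proof
    fix x assume "x \<in> S"
    then obtain n where n: "\<And>y. map y [0..<n] = map x [0..<n] \<Longrightarrow> y \<in> S"
      using * by blast
    define U where "U i = (if i < n then {x i} else UNIV)" for i
    have "finite {i. U i \<noteq> UNIV}"
      by (rule finite_subset[of _ "{..<n}"]) (auto simp: U_def split: if_splits)
    moreover have "Pi\<^sub>E UNIV U \<subseteq> S"
    proof
      fix y assume y: "y \<in> Pi\<^sub>E UNIV U"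
      have "y i = x i" if "i < n" for i
        using y that PiE_mem[of y UNIV U i] by (simp add: U_def)
      then show "y \<in> S"
        by (intro n) simp
    qed
    moreover have "x \<in> Pi\<^sub>E UNIV U"
      by (auto simp: U_def)
    ultimately show "\<exists>U. finite {i \<in> UNIV. U i \<noteq> topspace (discrete_topology UNIV)} \<and>
        (\<forall>i\<in>UNIV. openin (discrete_topology UNIV) (U i)) \<and> x \<in> Pi\<^sub>E UNIV U \<and> Pi\<^sub>E UNIV U \<subseteq> S"
      by (intro exI[of _ U]) simp
  qed
qed

text \<open>Membership is decided by \<open>n\<close> letters, so the complement contains the whole
  length-\<open>n\<close> cylinder around each of its points.\<close>

lemma closedin_cantor_prefix: "closedin cantor_space {x. P (map x [0..<n])}"
proof -
  have "openin cantor_space (UNIV - {x. P (map x [0..<n])})"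
    unfolding openin_cantor_space
  proof
    fix x assume "x \<in> UNIV - {x. P (map x [0..<n])}"
    then show "\<exists>n'. \<forall>y. map y [0..<n'] = map x [0..<n'] \<longrightarrow> y \<in> UNIV - {x. P (map x [0..<n])}"
      by (intro exI[of _ n]) (metis DiffD2 DiffI UNIV_I mem_Collect_eq)
  qed
  then show ?thesis
    by (simp add: closedin_def)
qed

lemma completely_metrizable_cantor_space: "completely_metrizable_space cantor_space"
  by (simp add: cantor_space_def completely_metrizable_space_product_topology
      completely_metrizable_space_discrete_topology)

text \<open>Density expressed by prefixes: a nonempty relatively open set contains the trace on
  \<open>F\<close> of a cylinder around a point of \<open>F\<close>, and the hypothesis finds a
  point of \<open>U\<close> there.\<close>

lemma closure_of_cantor_dense:
  assumes "\<And>x n. x \<in> F \<Longrightarrow> \<exists>y\<in>F \<inter> U. map y [0..<n] = map x [0..<n]"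
  shows "subtopology cantor_space F closure_of (U \<inter> F) = F"
proof -
  have "subtopology cantor_space F closure_of (U \<inter> F) = topspace (subtopology cantor_space F)"
    unfolding dense_intersects_open
  proof (intro allI impI, elim conjE)
    fix T assume "openin (subtopology cantor_space F) T" "T \<noteq> {}"
    then obtain W x where W: "openin cantor_space W" "T = W \<inter> F" "x \<in> W" "x \<in> F"
      by (auto simp: openin_subtopology)
    then obtain n where "\<And>y. map y [0..<n] = map x [0..<n] \<Longrightarrow> y \<in> W"
      by (meson openin_cantor_space)
    then show "U \<inter> F \<inter> T \<noteq> {}"
      using assms[OF W(4), of n] W(2) by blast
  qed
  then show ?thesis
    by simp
qed

text \<open>The Baire category theorem in the subspace \<open>F\<close>, which is completely
  metrizable because it is closed.\<close>

lemma dense_gdelta_cantor_meet: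
  assumes "closedin cantor_space F" "F \<noteq> {}" "gdelta_in cantor_space A" "gdelta_in cantor_space B"
    and A: "\<And>x n. x \<in> F \<Longrightarrow> \<exists>y\<in>F \<inter> A. map y [0..<n] = map x [0..<n]"
    and B: "\<And>x n. x \<in> F \<Longrightarrow> \<exists>y\<in>F \<inter> B. map y [0..<n] = map x [0..<n]"
  shows "A \<inter> B \<noteq> {}"
proof -
  let ?X = "subtopology cantor_space F"
  obtain C D :: "nat \<Rightarrow> (nat \<Rightarrow> bool) set"
    where C: "\<And>n. openin cantor_space (C n)" "\<Inter> (range C) = A"
      and D: "\<And>n. openin cantor_space (D n)" "\<Inter> (range D) = B"
    using assms(3,4) unfolding gdelta_in_descending by metis
  \<comment> \<open>Traces on \<open>F\<close> of the open sets whose intersections are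
    \<open>A\<close> and \<open>B\<close>. Each is dense in \<open>F\<close> because it contains the
    trace of \<open>A\<close> or of \<open>B\<close>.\<close>
  define \<G> where "\<G> = range (\<lambda>n. C n \<inter> F) \<union> range (\<lambda>n. D n \<inter> F)"
  have "?X closure_of \<Inter>\<G> = topspace ?X"
  proof (rule Baire_category)
    show "completely_metrizable_space ?X \<or> locally_compact_space ?X \<and> regular_space ?X"
      using completely_metrizable_space_closedin[OF completely_metrizable_cantor_space assms(1)] ..
    show "countable \<G>"
      by (simp add: \<G>_def)
    fix T assume "T \<in> \<G>"
    then consider n where "T = C n \<inter> F" | n where "T = D n \<inter> F"
      by (auto simp: \<G>_def)
    then show "openin ?X T \<and> ?X closure_of T = topspace ?X"
    proof cases
      case 1
      have "\<exists>y\<in>F \<inter> C n. map y [0..<k] = map x [0..<k]" if "x \<in> F" for x k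
        using A[OF that] C(2) by blast
      then have "?X closure_of T = topspace ?X"
        unfolding 1 by (simp add: closure_of_cantor_dense)
      moreover have "openin ?X T"
        unfolding 1 using C(1)[of n] by (rule openin_subtopology_Int)
      ultimately show ?thesis
        by simp
    next
      case 2
      have "\<exists>y\<in>F \<inter> D n. map y [0..<k] = map x [0..<k]" if "x \<in> F" for x k
        using B[OF that] D(2) by blast
      then have "?X closure_of T = topspace ?X"
        unfolding 2 by (simp add: closure_of_cantor_dense)
      moreover have "openin ?X T"
        unfolding 2 using D(1)[of n] by (rule openin_subtopology_Int)
      ultimately show ?thesis
        by simp
    qed
  qed
  \<comment> \<open>The closure of the empty set is empty, whereas here the closure is the nonempty
    \<open>F\<close>.\<close>
  then have "\<Inter>\<G> \<noteq> {}"
    using assms(2) by auto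
  moreover have "\<Inter>\<G> \<subseteq> A \<inter> B"
    using C(2) D(2) by (auto simp: \<G>_def)
  ultimately show ?thesis
    by blast
qed

section \<open>Borel class of the omega-power\<close>

lemma closedin_nonneg_paths: "closedin cantor_space nonneg_paths"
proof -
  have "nonneg_paths = (\<Inter>n. {x. 0 \<le> balance (map x [0..<n])})"
    by (auto simp: nonneg_paths_def height_def)
  moreover have "closedin cantor_space \<dots>"
    by (intro closedin_INT closedin_cantor_prefix) simp
  ultimately show ?thesis
    by simp
qed

lemma fsigma_accepted: "fsigma_in cantor_space accepted"
proof -
  \<comment> \<open>Fixing the time \<open>n\<close> from which the height is at least 1 gives a
    closed set. Its paths are accepted whether marked or not, so the other piece needs only the
    unmarked paths.\<close>
  define K where "K n = nonneg_paths \<inter> (\<Inter>m\<in>{n..}. {x. 1 \<le> balance (map x [0..<m])})" for n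
  have K: "closedin cantor_space (K n)" for n
    unfolding K_def
    by (intro closedin_Int closedin_nonneg_paths closedin_INT closedin_cantor_prefix) auto
  have "closedin cantor_space (nonneg_paths \<inter> {x. map x [0..<4] \<noteq> [True, False, True, True]})"
    by (intro closedin_Int closedin_nonneg_paths closedin_cantor_prefix)
  moreover have "fsigma_in cantor_space (\<Union>(range K))"
    by (intro fsigma_in_Union) (auto intro: closed_imp_fsigma_in K)
  moreover have "accepted =
      (nonneg_paths \<inter> {x. map x [0..<4] \<noteq> [True, False, True, True]}) \<union> \<Union>(range K)"
    by (auto simp: accepted_def marked_def K_def height_def)
  ultimately show ?thesis
    by (metis closed_imp_fsigma_in fsigma_in_Un)
qed

text \<open>For the density of \<open>accepted\<close>: keep a prefix and continue with up-steps
  only.\<close>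

lemma splice_True:
  fixes n :: nat
  assumes "x \<in> nonneg_paths"
  defines "y \<equiv> \<lambda>i. if i < n then x i else True"
  shows "y \<in> nonneg_paths" "\<forall>m\<ge>Suc n. 1 \<le> height y m"
proof -
  have le: "height y m = height x m" if "m \<le> n" for m
    using that by (induction m) (auto simp: y_def)
  have ge: "height y (n + k) = height x n + int k" for k
    using le[of n] by (induction k) (auto simp: y_def)
  have nonneg: "0 \<le> height x m" for m
    using assms(1) by (simp add: nonneg_paths_def)
  \<comment> \<open>With truncated subtraction this single bound gives both claims: it is 0 up to
    position \<open>n\<close> and positive afterwards.\<close>
  have "int (m - n) \<le> height y m" for m
  proof (cases "m \<le> n")
    case True
    then show ?thesis
      using le nonneg by simp
  next
    case False
    then show ?thesis
      using ge[of "m - n"] nonneg[of n] by simp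
  qed
  note * = this
  have "0 \<le> height y m" for m
    using *[of m] by linarith
  then show "y \<in> nonneg_paths"
    by (simp add: nonneg_paths_def)
  show "\<forall>m\<ge>Suc n. 1 \<le> height y m"
  proof (intro allI impI)
    fix m assume "Suc n \<le> m"
    then show "1 \<le> height y m"
      using *[of m] by simp
  qed
qed

text \<open>For the density of the complement: any prefix of a nonnegative path can be continued so
  that level 0 is visited infinitely often.\<close>

lemma splice_return:
  assumes "x \<in> nonneg_paths"
  obtains y where "y \<in> nonneg_paths" "map y [0..<n] = map x [0..<n]"
    "\<And>m. \<exists>k\<ge>m. height y k = 0"
proof -
  define h where "h = nat (height x n)"
  have nonneg: "0 \<le> height x m" for m
    using assms(1) by (simp add: nonneg_paths_def)
  \<comment> \<open>After the prefix, \<open>h\<close> down-steps lead exactly to level 0; from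
    there up-steps and down-steps alternate.\<close>
  define y where "y i = (if i < n then x i else n + h \<le> i \<and> even (i - (n + h)))" for i
  have before: "height y m = height x m" if "m \<le> n" for m
    using that by (induction m) (auto simp: y_def)
  have descent: "height y (n + k) = int h - int k" if "k \<le> h" for k
    using that before[of n] nonneg[of n] by (induction k) (auto simp: y_def h_def)
  have zigzag: "height y (n + h + k) = (if even k then 0 else 1)" for k
    using descent[of h] by (induction k) (auto simp: y_def)
  have "0 \<le> height y m" for m
  proof -
    consider "m \<le> n" | "n \<le> m" "m \<le> n + h" | "n + h \<le> m"
      by linarith
    then show ?thesis
    proof cases
      case 1
      then show ?thesis
        using before nonneg by simp
    next
      case 2
      then show ?thesis
        using descent[of "m - n"] by simp
    next
      case 3
      then show ?thesis
        using zigzag[of "m - (n + h)"] by simp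
    qed
  qed
  moreover have "map y [0..<n] = map x [0..<n]"
    by (simp add: y_def)
  moreover have "\<exists>k\<ge>m. height y k = 0" for m
    using zigzag[of "2 * m"] by (intro exI[of _ "n + h + 2 * m"]) simp
  ultimately show ?thesis
    by (intro that) (auto simp: nonneg_paths_def)
qed

lemma marked_cong:
  assumes "map y [0..<n] = map x [0..<n]" "4 \<le> n" "x \<in> marked"
  shows "y \<in> marked"
proof -
  have "map y [0..<4] = map x [0..<4]"
    using arg_cong[OF assms(1), of "take 4"] assms(2) by (simp add: take_map)
  then show ?thesis
    using assms(3) unfolding marked_def mem_Collect_eq by (rule trans)
qed

text \<open>The complement is a countable intersection of open sets by
  \<open>fsigma_accepted\<close>. If \<open>accepted\<close> were one as well, density of both in
  \<open>?F\<close> would give them a common point.\<close>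

lemma not_gdelta_accepted: "\<not> gdelta_in cantor_space accepted"
proof
  assume gdelta: "gdelta_in cantor_space accepted"
  let ?F = "nonneg_paths \<inter> marked"
  \<comment> \<open>Prefixes are lengthened to at least four letters so that the modified paths keep
    the beginning 1011.\<close>
  have mono: "map y [0..<n] = map x [0..<n]"
    if "map y [0..<max 4 n] = map x [0..<max 4 n]" for x y :: "nat \<Rightarrow> bool" and n
    using arg_cong[OF that, of "take n"] by (simp add: take_map)
  have "accepted \<inter> (topspace cantor_space - accepted) \<noteq> {}"
  proof (rule dense_gdelta_cantor_meet[of ?F])
    show "closedin cantor_space ?F"
      unfolding marked_def by (intro closedin_Int closedin_nonneg_paths closedin_cantor_prefix)
    \<comment> \<open>The path 10111... witnesses that \<open>?F\<close> is nonempty.\<close>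
    define x :: "nat \<Rightarrow> bool" where "x i = (i \<noteq> 1)" for i
    have "height x (Suc (Suc m)) = int m" for m
      by (induction m) (auto simp: x_def)
    note height_x = this
    have "0 \<le> height x m" for m
    proof (cases "m < 2")
      case True
      then show ?thesis
        by (cases m) (auto simp: x_def)
    next
      case False
      then show ?thesis
        using height_x[of "m - 2"] by (simp add: numeral_2_eq_2 Suc_diff_Suc)
    qed
    then have "x \<in> ?F"
      by (auto simp: nonneg_paths_def marked_def x_def numeral_eq_Suc)
    then show "?F \<noteq> {}"
      by blast
    show "gdelta_in cantor_space accepted"
      by (rule gdelta)
    show "gdelta_in cantor_space (topspace cantor_space - accepted)"
      using fsigma_accepted by (simp add: fsigma_in_gdelta_in)
  next
    fix x n assume x: "x \<in> ?F"
    define y where "y = (\<lambda>i. if i < max 4 n then x i else True)"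
    have eq: "map y [0..<max 4 n] = map x [0..<max 4 n]"
      by (simp add: y_def)
    have "y \<in> accepted" "y \<in> nonneg_paths"
      using splice_True[of x "max 4 n"] x unfolding accepted_def y_def by blast+
    then show "\<exists>y\<in>?F \<inter> accepted. map y [0..<n] = map x [0..<n]"
      using marked_cong[OF eq] mono[OF eq] x by auto
  next
    fix x n assume x: "x \<in> ?F"
    then obtain y where y: "y \<in> nonneg_paths" "map y [0..<max 4 n] = map x [0..<max 4 n]"
      "\<And>m. \<exists>k\<ge>m. height y k = 0"
      using splice_return by blast
    have "y \<in> marked"
      using marked_cong[OF y(2)] x by simp
    \<comment> \<open>A marked path with arbitrarily late zeros cannot eventually stay at height at
      least 1.\<close>
    moreover from this have "y \<notin> accepted"
      using y(3) unfolding accepted_def by fastforce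
    ultimately show "\<exists>y\<in>?F \<inter> (topspace cantor_space - accepted). map y [0..<n] = map x [0..<n]"
      using y(1) mono[OF y(2)] by auto
  qed
  then show False
    by blast
qed

theorem theorem4:
  shows "\<exists>A :: bool list set. context_free A \<and>
           fsigma_in cantor_space (omega_power A) \<and>
           \<not> gdelta_in cantor_space (omega_power A)"
  using context_free_lang fsigma_accepted not_gdelta_accepted omega_power_lang by metis

end
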